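(* If $L$ is an oriented virtual link with $\ell$ components, then $$\widetilde J_L(1)=J_L(1)=\begin{cases}2^{\ell}&\text{if }L\text{ is even},\\ 0&\text{if }L\text{ is odd}.\end{cases}$$ The number $J_L(1)$ is independent of the choice of orientation.
   Context: **Virtual links.** Virtual links are equivalence classes of virtual link diagrams (with classical and virtual crossings) under classical and virtual Reidemeister moves. Let $D$ be a diagram of $L=K_1\cup\dots\cup K_\ell$. **Bracket and Jones polynomial.** $\langle L\rangle=\langle D\rangle$ is the Kauffman bracket determined by $\langle\text{crossing}\rangle=\langle A\text{-smoothing}\rangle-q\langle B\text{-smoothing}\rangle$ at each classical crossing, $\langle\bigcirc\cup D\rangle=(q^{-1}+q)\langle D\rangle$, $\langle\emptyset\rangle=1$, virtual crossings being ignored. The $A$-smoothing joins the two regions swept by rotating the over-strand counterclockwise (at a positive crossing it is the orientation-compatible smoothing); the $B$-smoothing is the other. The (oriented) Jones polynomial is $J_L(q)=(-1)^{-n_-}q^{n_+-2n_-}\langle L\rangle$, where $n_\pm$ are the numbers of positive/negative classical crossings. **Crossing numbers.** $s_+$ and $s_-$ are the numbers of positive and negative self-crossings (classical crossings of a component with itself). $m$ is the number of mixed crossings, i.e. classical crossings between different components. **Parities.** $\pi(K_i,K_j)\in\{0,1\}$ is the number of mixed crossings between $K_i$ and $K_j$ modulo 2; $\pi(K_i)$ is the number of mixed crossings involving $K_i$ modulo 2. A component is odd if $\pi(K_i)=1$ and even otherwise; a link is even if all its components are even, and odd otherwise. **Multi-core decomposition.** Given a link, delete all its odd components, then delete all components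 that are odd in the remaining sub-link, and so on until an even (possibly empty) sub-link remains; this is the core. Let $C_1$ be the core of $L$, $M_1=L\setminus C_1$, $C_2$ the core of $M_1$, $M_2=M_1\setminus C_2$, and so on, until $M_n$ is empty or has empty core. Then $L=C_1\cup\dots\cup C_n\cup M_n$. Put $p(K_i,K_j)=0$ if $K_i,K_j\in C_r$ for some $r$, and $p(K_i,K_j)=1$ otherwise. **Unoriented Jones polynomial.** $Lk(K_i,K_j)\in\frac12\mathbb Z$ is half the sum of the signs of the mixed crossings between $K_i$ and $K_j$; $$\widetilde{Lk}(K_i,K_j)=(-1)^{p(K_i,K_j)\left(Lk(K_i,K_j)+\frac12\pi(K_i,K_j)\right)}Lk(K_i,K_j),\qquad \tilde\lambda=\sum_{1\le i<j\le\ell}\widetilde{Lk}(K_i,K_j),$$ $$\widetilde J_L(q)=(-1)^{\left(\tilde\lambda-s_--\frac12m\right)}q^{\left(s_+-2s_--\frac12m\right)}\langle L\rangle .$$ *)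

theory Defs
  imports Complex_Main "HOL-Library.Multiset"
begin

section \<open>Oriented virtual link diagrams\<close>

text \<open>
  A diagram is an oriented 4-valent plane graph (possibly with circles free of vertices) whose
  vertices are positive, negative or virtual crossings.  Component \<open>K\<^sub>i\<close> is recorded as the cyclic
  word of its passages through crossings; the passage \<open>(c, s)\<close> traverses crossing \<open>c\<close> on strand
  \<open>s\<close>.  The empty word is a circle without crossings.  Every passage \<open>x\<close> has two half-edges
  \<open>(x, In)\<close> and \<open>(x, Out)\<close>.  At a virtual crossing the names \<open>Over\<close> and \<open>Under\<close> carry no height
  information; they only encode the cyclic order of the four half-edges (see \<open>ccw\<close>).
  The value of \<open>kind\<close> at unused labels is irrelevant.
\<close>

datatype kind = Positive | Negative | Virtual
datatype strand = Over | Under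
datatype side = In | Out

type_synonym passage = "nat \<times> strand"
type_synonym half_edge = "passage \<times> side"

record diagram =
  code :: "passage list list"
  kind :: "nat \<Rightarrow> kind"

fun other :: "strand \<Rightarrow> strand" where
  "other Over = Under"
| "other Under = Over"

fun opp :: "side \<Rightarrow> side" where
  "opp In = Out"
| "opp Out = In"

definition labels :: "diagram \<Rightarrow> nat set" where
  "labels D = fst ` set (concat (code D))"

definition classical :: "diagram \<Rightarrow> nat set" where
  "classical D = {c \<in> labels D. kind D c \<noteq> Virtual}"

definition well_formed :: "diagram \<Rightarrow> bool" where
  "well_formed D \<longleftrightarrow> distinct (concat (code D)) \<and>
     (\<forall>c. (c, Over) \<in> set (concat (code D)) \<longleftrightarrow> (c, Under) \<in> set (concat (code D)))"

definition half_edges :: "diagram \<Rightarrow> half_edge set" where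
  "half_edges D = set (concat (code D)) \<times> UNIV"

definition arcs :: "diagram \<Rightarrow> (half_edge \<times> half_edge) set" where
  "arcs D = {((w ! k, Out), (w ! (Suc k mod length w), In)) | w k. w \<in> set (code D) \<and> k < length w}"

text \<open>
  The counterclockwise successor of a half-edge at its crossing.  The counterclockwise order is
  over-out, under-out, over-in, under-in at a positive (and, by convention, at a virtual) crossing
  and over-out, under-in, over-in, under-out at a negative crossing.
\<close>

fun ccw :: "diagram \<Rightarrow> half_edge \<Rightarrow> half_edge" where
  "ccw D ((c, Over), e) = ((c, Under), if kind D c = Negative then opp e else e)"
| "ccw D ((c, Under), e) = ((c, Over), if kind D c = Negative then e else opp e)"

definition num_classes :: "'a set \<Rightarrow> ('a \<times> 'a) set \<Rightarrow> nat" where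
  "num_classes X r = card (X // (r \<union> r\<inverse>)\<^sup>*)"

text \<open>
  Walk along an edge from the half-edge \<open>h\<close> to its other end \<open>h'\<close>, then turn to the
  counterclockwise successor of \<open>h'\<close>: this follows the boundary of the face to the right, so the
  cycles of \<open>face_step\<close> are the faces.
\<close>

definition face_step :: "diagram \<Rightarrow> (half_edge \<times> half_edge) set" where
  "face_step D = {(h, ccw D h') | h h'. (h, h') \<in> arcs D \<union> (arcs D)\<inverse>}"

definition num_pieces :: "diagram \<Rightarrow> nat" where
  "num_pieces D = num_classes (half_edges D) (arcs D \<union> {(h, ccw D h) | h. h \<in> half_edges D})"

text \<open>
  Planarity as Euler's formula \<open>V - E + F = 2\<close> for all connected pieces of the 4-valent graph
  (it is enough to require the sum of these equations, since \<open>V - E + F \<le> 2\<close> for each piece).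
\<close>

definition planar :: "diagram \<Rightarrow> bool" where
  "planar D \<longleftrightarrow>
     int (card (labels D)) - int (card (arcs D)) + int (num_classes (half_edges D) (face_step D))
       = 2 * int (num_pieces D)"

definition virtual_link_diagram :: "diagram \<Rightarrow> bool" where
  "virtual_link_diagram D \<longleftrightarrow> well_formed D \<and> planar D"


section \<open>Reidemeister moves and virtual links\<close>

text \<open>Equality of diagrams up to names of crossings, order of components and base points.\<close>

definition same_diagram :: "diagram \<Rightarrow> diagram \<Rightarrow> bool" where
  "same_diagram D D' \<longleftrightarrow>
     (\<exists>f ws. inj_on f (labels D) \<and> (\<forall>c\<in>labels D. kind D' (f c) = kind D c) \<and>
        mset ws = mset (code D') \<and>
        list_all2 (\<lambda>u v. \<exists>k. v = rotate k (map (map_prod f id) u)) (code D) ws)"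

definition remove_crossings :: "nat set \<Rightarrow> diagram \<Rightarrow> diagram" where
  "remove_crossings C D = D\<lparr>code := map (filter (\<lambda>x. fst x \<notin> C)) (code D)\<rparr>"

text \<open>
  The moves are described by the face that they collapse or invert: a monogon, a bigon or a
  triangle.  A bigon or triangle can be moved if one of its edges belongs to a strand which passes
  over both crossings at the ends of this edge, or which passes both of them virtually.
\<close>

definition movable_edge :: "diagram \<Rightarrow> passage \<Rightarrow> passage \<Rightarrow> bool" where
  "movable_edge D x y \<longleftrightarrow>
     kind D (fst x) = Virtual \<and> kind D (fst y) = Virtual \<or>
     kind D (fst x) \<noteq> Virtual \<and> kind D (fst y) \<noteq> Virtual \<and> snd x = Over \<and> snd y = Over"

definition edge :: "diagram \<Rightarrow> half_edge \<Rightarrow> half_edge \<Rightarrow> bool" where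
  "edge D h h' \<longleftrightarrow> (h, h') \<in> arcs D \<union> (arcs D)\<inverse>"

text \<open>First move, classical or virtual.\<close>

definition move1 :: "diagram \<Rightarrow> diagram \<Rightarrow> bool" where
  "move1 D D' \<longleftrightarrow> (\<exists>h. (h, h) \<in> face_step D \<and> D' = remove_crossings {fst (fst h)} D)"

text \<open>Second move, classical or virtual.\<close>

definition move2 :: "diagram \<Rightarrow> diagram \<Rightarrow> bool" where
  "move2 D D' \<longleftrightarrow>
     (\<exists>x e y e' z d.
        edge D (x, e) (z, d) \<and> (y, e') = ccw D (z, d) \<and> ((y, e'), (x, e)) \<in> face_step D \<and>
        fst x \<noteq> fst y \<and> movable_edge D x z \<and> D' = remove_crossings {fst x, fst y} D)"

text \<open>
  Third move: the triangle has the crossings \<open>fst x\<^sub>1\<close>, \<open>fst x\<^sub>2\<close>, \<open>fst x\<^sub>3\<close> and the edges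
  \<open>x\<^sub>1 z\<^sub>1\<close>, \<open>x\<^sub>2 z\<^sub>2\<close>, \<open>x\<^sub>3 z\<^sub>3\<close>; the first edge is moved across the crossing \<open>fst x\<^sub>3\<close>, so that
  each of the three strands meets its two crossings in the opposite order.  If the first edge is
  virtual, then \<open>fst x\<^sub>3\<close> may be virtual (purely virtual move) or classical (mixed move); otherwise it
  must be classical, which excludes the two forbidden moves.
\<close>

definition swap_passages :: "(passage \<times> passage) list \<Rightarrow> diagram \<Rightarrow> diagram" where
  "swap_passages ps D =
     D\<lparr>code := map (map (\<lambda>x. case map_of (ps @ map prod.swap ps) x of None \<Rightarrow> x | Some y \<Rightarrow> y)) (code D)\<rparr>"

definition move3 :: "diagram \<Rightarrow> diagram \<Rightarrow> bool" where
  "move3 D D' \<longleftrightarrow>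
     (\<exists>x1 e1 z1 d1 x2 e2 z2 d2 x3 e3 z3 d3.
        edge D (x1, e1) (z1, d1) \<and> (x2, e2) = ccw D (z1, d1) \<and>
        edge D (x2, e2) (z2, d2) \<and> (x3, e3) = ccw D (z2, d2) \<and>
        edge D (x3, e3) (z3, d3) \<and> (x1, e1) = ccw D (z3, d3) \<and>
        distinct [fst x1, fst x2, fst x3] \<and>
        movable_edge D x1 z1 \<and> (kind D (fst x1) = Virtual \<or> kind D (fst x3) \<noteq> Virtual) \<and>
        D' = swap_passages [(x1, z1), (x2, z2), (x3, z3)] D)"

definition moves :: "(diagram \<times> diagram) set" where
  "moves = {(D, D'). virtual_link_diagram D \<and> virtual_link_diagram D' \<and>
     (same_diagram D D' \<or> move1 D D' \<or> move2 D D' \<or> move3 D D')}"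

text \<open>An oriented virtual link is the set of all diagrams that represent it.\<close>

definition virtual_links :: "diagram set set" where
  "virtual_links = {D. virtual_link_diagram D} // (moves \<union> moves\<inverse>)\<^sup>*"


section \<open>Kauffman bracket and Jones polynomial\<close>

text \<open>
  A crossing is smoothed by joining its half-edges in pairs.  The two regions swept by rotating the
  over-strand counterclockwise lie between an over-end and its counterclockwise successor; joining
  these regions (\<open>A\<close>-smoothing) connects each under-end to its counterclockwise successor.  The
  \<open>B\<close>-smoothing connects each over-end to its counterclockwise successor.  The set \<open>B\<close> consists of
  the classical crossings with a \<open>B\<close>-smoothing, all others have an \<open>A\<close>-smoothing.
\<close>

definition joins :: "diagram \<Rightarrow> nat set \<Rightarrow> (half_edge \<times> half_edge) set" where
  "joins D B =
     {(((c, s), In), ((c, s), Out)) | c s. c \<in> labels D \<and> kind D c = Virtual} \<union>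
     {(((c, Under), e), ccw D ((c, Under), e)) | c e. c \<in> classical D - B} \<union>
     {(((c, Over), e), ccw D ((c, Over), e)) | c e. c \<in> classical D \<inter> B}"

definition num_circles :: "diagram \<Rightarrow> nat set \<Rightarrow> nat" where
  "num_circles D B =
     num_classes (half_edges D) (arcs D \<union> joins D B) + length (filter (\<lambda>w. w = []) (code D))"

text \<open>
  \<open>skein D q cs B\<close> is the bracket of the diagram in which the crossings \<open>cs\<close> are not yet smoothed,
  the crossings in \<open>B\<close> have been \<open>B\<close>-smoothed and the other classical crossings \<open>A\<close>-smoothed.
\<close>

primrec skein :: "diagram \<Rightarrow> real \<Rightarrow> nat list \<Rightarrow> nat set \<Rightarrow> real" where
  "skein D q [] B = (inverse q + q) ^ num_circles D B"
| "skein D q (c # cs) B = skein D q cs B - q * skein D q cs (insert c B)"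

definition bracket :: "diagram \<Rightarrow> real \<Rightarrow> real" where
  "bracket D q = skein D q (sorted_list_of_set (classical D)) {}"

definition num_pos :: "diagram \<Rightarrow> nat" where
  "num_pos D = card {c \<in> labels D. kind D c = Positive}"

definition num_neg :: "diagram \<Rightarrow> nat" where
  "num_neg D = card {c \<in> labels D. kind D c = Negative}"

definition jones :: "diagram \<Rightarrow> real \<Rightarrow> real" where
  "jones D q = (-1) powi (- int (num_neg D)) * q powi (int (num_pos D) - 2 * int (num_neg D))
     * bracket D q"


section \<open>Components, parities and the multi-core decomposition\<close>

definition num_comps :: "diagram \<Rightarrow> nat" where
  "num_comps D = length (code D)"

definition comp_of :: "diagram \<Rightarrow> passage \<Rightarrow> nat" where
  "comp_of D x = (THE i. i < length (code D) \<and> x \<in> set (code D ! i))"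

definition crossings_between :: "diagram \<Rightarrow> nat \<Rightarrow> nat \<Rightarrow> nat set" where
  "crossings_between D i j =
     {c \<in> classical D. {comp_of D (c, Over), comp_of D (c, Under)} = {i, j}}"

definition mixed_crossings :: "diagram \<Rightarrow> nat set" where
  "mixed_crossings D = {c \<in> classical D. comp_of D (c, Over) \<noteq> comp_of D (c, Under)}"

definition self_pos :: "diagram \<Rightarrow> nat" where
  "self_pos D = card {c \<in> labels D. kind D c = Positive \<and> comp_of D (c, Over) = comp_of D (c, Under)}"

definition self_neg :: "diagram \<Rightarrow> nat" where
  "self_neg D = card {c \<in> labels D. kind D c = Negative \<and> comp_of D (c, Over) = comp_of D (c, Under)}"

definition pair_parity :: "diagram \<Rightarrow> nat \<Rightarrow> nat \<Rightarrow> nat" where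
  "pair_parity D i j = card (crossings_between D i j) mod 2"

text \<open>A set \<open>X\<close> of component indices stands for the sub-link consisting of these components.\<close>

definition parity_in :: "diagram \<Rightarrow> nat set \<Rightarrow> nat \<Rightarrow> nat" where
  "parity_in D X i = card (\<Union>j\<in>X - {i}. crossings_between D i j) mod 2"

definition even_sublink :: "diagram \<Rightarrow> nat set \<Rightarrow> bool" where
  "even_sublink D X \<longleftrightarrow> (\<forall>i\<in>X. parity_in D X i = 0)"

definition even_link :: "diagram \<Rightarrow> bool" where
  "even_link D \<longleftrightarrow> even_sublink D {..<num_comps D}"

definition delete_odd :: "diagram \<Rightarrow> nat set \<Rightarrow> nat set" where
  "delete_odd D X = {i \<in> X. parity_in D X i = 0}"

definition core :: "diagram \<Rightarrow> nat set \<Rightarrow> nat set" where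
  "core D X = (delete_odd D ^^ (LEAST k. even_sublink D ((delete_odd D ^^ k) X))) X"

text \<open>
  \<open>remainder D r\<close> is \<open>M\<^sub>r\<close>, where \<open>M\<^sub>0\<close> is the whole link, and \<open>multi_core D r\<close> is \<open>C\<^sub>r\<^sub>+\<^sub>1\<close>.  After
  the last step of the decomposition \<open>multi_core D r\<close> is empty.
\<close>

primrec remainder :: "diagram \<Rightarrow> nat \<Rightarrow> nat set" where
  "remainder D 0 = {..<num_comps D}"
| "remainder D (Suc r) = remainder D r - core D (remainder D r)"

definition multi_core :: "diagram \<Rightarrow> nat \<Rightarrow> nat set" where
  "multi_core D r = core D (remainder D r)"

definition core_distance :: "diagram \<Rightarrow> nat \<Rightarrow> nat \<Rightarrow> nat" where
  "core_distance D i j = (if \<exists>r. i \<in> multi_core D r \<and> j \<in> multi_core D r then 0 else 1)"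


section \<open>Unoriented Jones polynomial\<close>

definition crossing_sign :: "diagram \<Rightarrow> nat \<Rightarrow> int" where
  "crossing_sign D c = (if kind D c = Positive then 1 else -1)"

definition lk :: "diagram \<Rightarrow> nat \<Rightarrow> nat \<Rightarrow> real" where
  "lk D i j = of_int (\<Sum>c\<in>crossings_between D i j. crossing_sign D c) / 2"

text \<open>
  The real exponents of \<open>-1\<close> below are integers (see \<open>lk_exponent_Ints\<close> and
  \<open>unoriented_exponent_Ints\<close>), so that the floor function merely converts them to type \<open>int\<close>.
\<close>

definition ulk :: "diagram \<Rightarrow> nat \<Rightarrow> nat \<Rightarrow> real" where
  "ulk D i j =
     (-1) powi \<lfloor>real (core_distance D i j) * (lk D i j + real (pair_parity D i j) / 2)\<rfloor> * lk D i j"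

definition lambda_tilde :: "diagram \<Rightarrow> real" where
  "lambda_tilde D = (\<Sum>(i, j) | i < j \<and> j < num_comps D. ulk D i j)"

text \<open>The exponent of \<open>q\<close> can be a half-integer, hence \<open>q\<close> is understood to be positive.\<close>

definition unoriented_jones :: "diagram \<Rightarrow> real \<Rightarrow> real" where
  "unoriented_jones D q =
     (-1) powi \<lfloor>lambda_tilde D - real (self_neg D) - real (card (mixed_crossings D)) / 2\<rfloor>
     * q powr (real (self_pos D) - 2 * real (self_neg D) - real (card (mixed_crossings D)) / 2)
     * bracket D q"


section \<open>Change of orientation\<close>

definition toggled :: "nat set \<Rightarrow> diagram \<Rightarrow> nat \<Rightarrow> bool" where
  "toggled I D c \<longleftrightarrow> (comp_of D (c, Over) \<in> I) \<noteq> (comp_of D (c, Under) \<in> I)"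

text \<open>
  Reversing exactly one strand changes the sign of a classical crossing.  At a virtual crossing it
  changes the cyclic order of half-edges, which amounts to exchanging the names of the strands.
\<close>

definition reorient :: "nat set \<Rightarrow> diagram \<Rightarrow> diagram" where
  "reorient I D =
     \<lparr>code = map (\<lambda>i. map (\<lambda>(c, s). (c, if kind D c = Virtual \<and> toggled I D c then other s else s))
                (if i \<in> I then rev (code D ! i) else code D ! i)) [0..<num_comps D],
      kind = (\<lambda>c. if \<not> toggled I D c then kind D c else
                (case kind D c of Positive \<Rightarrow> Negative | Negative \<Rightarrow> Positive | Virtual \<Rightarrow> Virtual))\<rparr>"


section \<open>Sanity checks\<close>

lemma finite_labels [simp]: "finite (labels D)"
  by (simp add: labels_def)

lemma finite_classical [simp]: "finite (classical D)"
  by (simp add: classical_def)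

lemma finite_crossings_between [simp]: "finite (crossings_between D i j)"
  by (simp add: crossings_between_def)

text \<open>The bracket is the usual state sum; in particular it does not depend on the order in which the
  crossings are smoothed.\<close>

lemma skein_state_sum:
  assumes "distinct cs" "set cs \<inter> B = {}"
  shows "skein D q cs B = (\<Sum>S\<in>Pow (set cs). (- q) ^ card S * (inverse q + q) ^ num_circles D (B \<union> S))"
  using assms
proof (induction cs arbitrary: B)
  case (Cons c cs)
  have inj: "inj_on (insert c) (Pow (set cs))"
    using Cons.prems by (auto simp: inj_on_def)
  have disj: "Pow (set cs) \<inter> insert c ` Pow (set cs) = {}"
    using Cons.prems by auto
  let ?g = "\<lambda>B S. (- q) ^ card S * (inverse q + q) ^ num_circles D (B \<union> S)"
  have "(\<Sum>S\<in>Pow (set (c # cs)). ?g B S) =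
        (\<Sum>S\<in>Pow (set cs). ?g B S) + (\<Sum>S\<in>insert c ` Pow (set cs). ?g B S)"
    using disj by (simp add: Pow_insert sum.union_disjoint)
  also have "(\<Sum>S\<in>insert c ` Pow (set cs). ?g B S) = (\<Sum>S\<in>Pow (set cs). ?g B (insert c S))"
    using inj by (simp add: sum.reindex)
  also have "\<dots> = (\<Sum>S\<in>Pow (set cs). - q * ?g (insert c B) S)"
  proof (rule sum.cong)
    fix S assume S: "S \<in> Pow (set cs)"
    then have "finite S" "c \<notin> S" using Cons.prems by (auto intro: finite_subset)
    then show "?g B (insert c S) = - q * ?g (insert c B) S" by simp
  qed simp
  also have "\<dots> = - q * (\<Sum>S\<in>Pow (set cs). ?g (insert c B) S)"
    by (simp add: sum_distrib_left)
  finally show ?case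
    using Cons.IH[of B] Cons.IH[of "insert c B"] Cons.prems by auto
qed simp

lemma bracket_empty: "bracket \<lparr>code = [], kind = k\<rparr> q = 1"
  by (simp add: bracket_def classical_def labels_def num_circles_def num_classes_def half_edges_def)

lemma bracket_circle:
  "bracket (D\<lparr>code := code D @ [[]]\<rparr>) q = (inverse q + q) * bracket D q"
proof -
  let ?D = "D\<lparr>code := code D @ [[]]\<rparr>"
  have lab: "labels ?D = labels D" and cl: "classical ?D = classical D"
    and he: "half_edges ?D = half_edges D" and ar: "arcs ?D = arcs D"
    by (auto simp: labels_def classical_def half_edges_def arcs_def)
  have cc: "ccw ?D h = ccw D h" for h
    by (cases "(D, h)" rule: ccw.cases) auto
  have "num_circles ?D B = Suc (num_circles D B)" for B
    unfolding num_circles_def joins_def lab cl he ar cc by simp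
  then have "skein ?D q cs B = (inverse q + q) * skein D q cs B" for cs B
    by (induction cs arbitrary: B) (auto simp: algebra_simps)
  then show ?thesis by (simp add: bracket_def cl)
qed

lemma sum_signs_card:
  assumes "finite C"
  shows "even ((\<Sum>c\<in>C. crossing_sign D c) + int (card C))"
  using assms by (induction C rule: finite_induct) (auto simp: crossing_sign_def)

lemma half_sum_Ints: "even (a + b) \<Longrightarrow> (of_int a / 2 + of_int b / 2 :: real) \<in> \<int>"
proof -
  assume "even (a + b)"
  then obtain k where k: "a + b = 2 * k" by blast
  have "(of_int a / 2 + of_int b / 2 :: real) = of_int (a + b) / 2"
    by (simp add: add_divide_distrib)
  also have "\<dots> = of_int k"
    unfolding k by simp
  finally show ?thesis by simp
qed

lemma lk_exponent_Ints:
  "real (core_distance D i j) * (lk D i j + real (pair_parity D i j) / 2) \<in> \<int>"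
proof -
  have "even ((\<Sum>c\<in>crossings_between D i j. crossing_sign D c) + int (pair_parity D i j))"
    using sum_signs_card[of "crossings_between D i j" D] by (simp add: pair_parity_def)
  from half_sum_Ints[OF this] show ?thesis
    by (simp add: lk_def)
qed

lemma ulk_half_Ints: "ulk D i j - real (card (crossings_between D i j)) / 2 \<in> \<int>"
proof -
  let ?s = "\<Sum>c\<in>crossings_between D i j. crossing_sign D c"
  let ?n = "int (card (crossings_between D i j))"
  have "(-1::real) powi k = 1 \<or> (-1::real) powi k = -1" for k :: int
    by (cases "even k") (auto simp: power_int_minus_left)
  then have "ulk D i j = lk D i j \<or> ulk D i j = - lk D i j"
    unfolding ulk_def by (metis mult_1 mult_minus1)
  moreover have "even (?s + - ?n)" "even (- ?s + - ?n)"
    using sum_signs_card[of "crossings_between D i j" D] by auto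
  from half_sum_Ints[OF this(1)] half_sum_Ints[OF this(2)]
  have "lk D i j - ?n / 2 \<in> \<int>" "- lk D i j - ?n / 2 \<in> \<int>"
    by (simp_all add: lk_def)
  ultimately show ?thesis by auto
qed

lemma distinct_concat_nth:
  assumes "distinct (concat xss)" "i < j" "j < length xss" "x \<in> set (xss ! i)"
  shows "x \<notin> set (xss ! j)"
  using assms
proof (induction xss arbitrary: i j)
  case (Cons xs xss)
  obtain j' where j': "j = Suc j'" "j' < length xss"
    using Cons.prems by (cases j) auto
  show ?case
  proof (cases i)
    case 0
    then have "x \<notin> set (concat xss)" using Cons.prems by auto
    moreover have "set (xss ! j') \<subseteq> set (concat xss)"
      using nth_mem[OF j'(2)] by auto
    ultimately show ?thesis using j' by auto
  next
    case (Suc i')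
    then show ?thesis using Cons.IH[of i' j'] Cons.prems j' by simp
  qed
qed simp

lemma comp_of_less:
  assumes "well_formed D" "c \<in> labels D"
  shows "comp_of D (c, s) < num_comps D"
proof -
  from assms(2) obtain t where t: "(c, t) \<in> set (concat (code D))"
    unfolding labels_def by force
  have "(c, Over) \<in> set (concat (code D)) \<longleftrightarrow> (c, Under) \<in> set (concat (code D))"
    using assms(1) unfolding well_formed_def by blast
  with t have "(c, s) \<in> set (concat (code D))"
    by (cases s; cases t) argo+
  then obtain w where w: "w \<in> set (code D)" "(c, s) \<in> set w"
    by auto
  from w(1) obtain i where "i < length (code D)" "code D ! i = w"
    by (auto simp: in_set_conv_nth)
  with w have i: "i < length (code D)" "(c, s) \<in> set (code D ! i)"
    by simp_all
  have dist: "distinct (concat (code D))"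
    using assms(1) unfolding well_formed_def by blast
  have "j = i" if j: "j < length (code D)" "(c, s) \<in> set (code D ! j)" for j
    using distinct_concat_nth[OF dist _ j(1) i(2)] distinct_concat_nth[OF dist _ i(1) j(2)] i(2) j(2)
      linorder_neqE_nat[of i j] by blast
  then have "comp_of D (c, s) = i"
    unfolding comp_of_def using i by (intro the_equality) blast+
  then show ?thesis using i(1) by (simp add: num_comps_def)
qed

lemma unoriented_exponent_Ints:
  assumes "well_formed D"
  shows "lambda_tilde D - real (self_neg D) - real (card (mixed_crossings D)) / 2 \<in> \<int>"
proof -
  let ?P = "{(i, j). i < j \<and> j < num_comps D}"
  have fin: "finite ?P"
    by (rule finite_subset[of _ "{..<num_comps D} \<times> {..<num_comps D}"]) auto
  have mix: "mixed_crossings D = (\<Union>p\<in>?P. crossings_between D (fst p) (snd p))"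
  proof (intro equalityI subsetI)
    fix c assume c: "c \<in> mixed_crossings D"
    let ?i = "comp_of D (c, Over)" and ?j = "comp_of D (c, Under)"
    from c have cl: "c \<in> classical D" and ne: "?i \<noteq> ?j" by (auto simp: mixed_crossings_def)
    then have "?i < num_comps D" "?j < num_comps D"
      using comp_of_less[OF assms] by (auto simp: classical_def)
    then have "(min ?i ?j, max ?i ?j) \<in> ?P" using ne by auto
    moreover have "c \<in> crossings_between D (min ?i ?j) (max ?i ?j)"
      using cl by (auto simp: crossings_between_def min_def max_def)
    ultimately show "c \<in> (\<Union>p\<in>?P. crossings_between D (fst p) (snd p))" by force
  next
    fix c assume "c \<in> (\<Union>p\<in>?P. crossings_between D (fst p) (snd p))"
    then obtain i j where "i < j" "c \<in> crossings_between D i j" by auto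
    then show "c \<in> mixed_crossings D"
      by (auto simp: crossings_between_def mixed_crossings_def doubleton_eq_iff)
  qed
  have "card (mixed_crossings D) = (\<Sum>p\<in>?P. card (crossings_between D (fst p) (snd p)))"
    unfolding mix
  proof (rule card_UN_disjoint[OF fin])
    show "\<forall>p\<in>?P. \<forall>q\<in>?P. p \<noteq> q \<longrightarrow>
      crossings_between D (fst p) (snd p) \<inter> crossings_between D (fst q) (snd q) = {}"
      by (auto simp: crossings_between_def doubleton_eq_iff)
  qed auto
  then have "lambda_tilde D - real (card (mixed_crossings D)) / 2 =
      (\<Sum>p\<in>?P. ulk D (fst p) (snd p) - real (card (crossings_between D (fst p) (snd p))) / 2)"
    by (simp add: lambda_tilde_def sum_subtractf sum_divide_distrib case_prod_beta)
  also have "\<dots> \<in> \<int>"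
    by (intro Ints_sum ulk_half_Ints)
  finally have "lambda_tilde D - real (card (mixed_crossings D)) / 2 \<in> \<int>" .
  then have "lambda_tilde D - real (card (mixed_crossings D)) / 2 - real (self_neg D) \<in> \<int>"
    by (rule Ints_diff) auto
  then show ?thesis by (simp add: algebra_simps)
qed

end

theory Submission
  imports Defs
begin

text \<open>
  For \<open>q = 1\<close> every circle of a state has weight 2, so the bracket counts pairs of a state and a
  2-colouring of its circles, with the sign of the state.  Exchanging the summations, one sums over
  the 2-colourings of the edges (constant along virtual passages) the product of local weights
  \<open>[A-smoothing compatible] - [B-smoothing compatible]\<close>.  A weight vanishes unless both strands switch
  colour at the crossing; if they do, it is the sign of the crossing times \<open>-(-1)\<^sup>x\<^sup>+\<^sup>y\<close>, where \<open>x\<close>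
  and \<open>y\<close> are the incoming colours.  If the colour switches at every classical passage, then exactly
  half of these passages have incoming colour 1, hence the signs \<open>-(-1)\<^sup>x\<^sup>+\<^sup>y\<close> multiply to 1 and the
  total weight is \<open>(-1)\<close> to the number of negative crossings.  A component has two switching
  colourings if it has an even number of classical passages, and none otherwise.

  If the link is even, then its first core is the whole link, so that \<open>lambda_tilde\<close> is the total
  linking number and the two normalisations agree; if it is odd, the bracket vanishes.
\<close>

section \<open>The bracket as a sum over colourings\<close>

text \<open>Unions of classes of the equivalence relation generated by \<open>r\<close>. Taken as
  the set of points of colour 1, such a union is a 2-colouring of the classes.\<close>

definition invariant_sets :: "'a set \<Rightarrow> ('a \<times> 'a) set \<Rightarrow> 'a set set" where
  "invariant_sets X r = {F. F \<subseteq> X \<and> (\<forall>(x, y)\<in>r. x \<in> F \<longleftrightarrow> y \<in> F)}"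

text \<open>An invariant set is the same as a choice of classes. Since \<open>r\<close> stays inside
  \<open>X\<close>, so does the class of any point of \<open>X\<close>. For a state, this turns the
  weight 2 of each circle into a number of colourings.\<close>

lemma card_invariant_sets:
  assumes "finite X" "r \<subseteq> X \<times> X"
  shows "card (invariant_sets X r) = 2 ^ num_classes X r"
proof -
  define E where "E = (r \<union> r\<inverse>)\<^sup>*"
  have E_sym: "(y, x) \<in> E" if "(x, y) \<in> E" for x y
    using that sym_rtrancl[of "r \<union> r\<inverse>"] unfolding E_def by (auto simp: sym_Un_converse dest: symD)
  have E_trans: "(x, z) \<in> E" if "(x, y) \<in> E" "(y, z) \<in> E" for x y z
    using that unfolding E_def by (rule rtrancl_trans)
  have E_refl: "(x, x) \<in> E" for x by (simp add: E_def)
  have E_X: "y \<in> X" if "(x, y) \<in> E" "x \<in> X" for x y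
    using that unfolding E_def by (induction rule: rtrancl_induct) (use assms in auto)
  have E_inv: "x \<in> F \<longleftrightarrow> y \<in> F" if "(x, y) \<in> E" "F \<in> invariant_sets X r" for x y F
    using that(1) unfolding E_def
    by (induction rule: rtrancl_induct) (use that(2) in \<open>auto simp: invariant_sets_def\<close>)
  have quot: "A \<subseteq> X" "A \<noteq> {}" "\<And>x y. x \<in> A \<Longrightarrow> y \<in> A \<longleftrightarrow> (x, y) \<in> E" if "A \<in> X // E" for A
  proof -
    from that obtain a where a: "a \<in> X" "A = E `` {a}" by (auto simp: quotient_def)
    show "A \<subseteq> X" "A \<noteq> {}" using a E_X E_refl by auto
    show "\<And>x y. x \<in> A \<Longrightarrow> y \<in> A \<longleftrightarrow> (x, y) \<in> E"
      unfolding a(2) using E_sym E_trans by blast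
  qed
  \<comment> \<open>The inverse of taking the union sends an invariant set to the classes contained
    in it.\<close>
  have "bij_betw \<Union> (Pow (X // E)) (invariant_sets X r)"
  proof (rule bij_betw_byWitness[where f' = "\<lambda>F. {A \<in> X // E. A \<subseteq> F}"])
    show "\<forall>S\<in>Pow (X // E). {A \<in> X // E. A \<subseteq> \<Union> S} = S"
    proof (intro ballI equalityI subsetI)
      fix S A assume S: "S \<in> Pow (X // E)" and A: "A \<in> {A \<in> X // E. A \<subseteq> \<Union> S}"
      then obtain x B where x: "x \<in> A" "x \<in> B" "B \<in> S" using quot(2)[of A] by blast
      then have "A = B" using A S quot(3)[of A x] quot(3)[of B x] by blast
      then show "A \<in> S" using x by simp
    qed auto
    show "\<forall>F\<in>invariant_sets X r. \<Union> {A \<in> X // E. A \<subseteq> F} = F"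
    proof (intro ballI equalityI subsetI)
      fix F x assume F: "F \<in> invariant_sets X r" and x: "x \<in> F"
      then have "E `` {x} \<in> X // E" "E `` {x} \<subseteq> F"
        using E_inv by (auto simp: quotient_def invariant_sets_def)
      then show "x \<in> \<Union> {A \<in> X // E. A \<subseteq> F}" using E_refl by blast
    qed auto
    show "\<Union> ` Pow (X // E) \<subseteq> invariant_sets X r"
    proof safe
      fix S assume S: "S \<subseteq> X // E"
      have "x \<in> \<Union> S \<longleftrightarrow> y \<in> \<Union> S" if "(x, y) \<in> r" for x y
      proof -
        have "(x, y) \<in> E" "(y, x) \<in> E" using that by (auto simp: E_def)
        then show ?thesis using S quot(3) by blast
      qed
      then show "\<Union> S \<in> invariant_sets X r"
        using S quot(1) unfolding invariant_sets_def by blast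
    qed
    show "(\<lambda>F. {A \<in> X // E. A \<subseteq> F}) ` invariant_sets X r \<subseteq> Pow (X // E)" by auto
  qed
  then have "card (invariant_sets X r) = card (Pow (X // E))" by (simp add: bij_betw_same_card)
  also have "\<dots> = 2 ^ card (X // E)"
  proof (rule card_Pow)
    have "X // E \<subseteq> Pow X" using quot(1) by blast
    then show "finite (X // E)" using assms(1) finite_subset by blast
  qed
  finally show ?thesis by (simp add: num_classes_def E_def)
qed

lemma prod_of_bool: "finite A \<Longrightarrow> (\<Prod>x\<in>A. of_bool (P x)) = (of_bool (\<forall>x\<in>A. P x) :: 'a :: comm_semiring_1)"
  by (induction A rule: finite_induct) auto

lemma passage_iff:
  assumes "well_formed D"
  shows "(c, s) \<in> set (concat (code D)) \<longleftrightarrow> c \<in> labels D"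
proof -
  have *: "(c, Over) \<in> set (concat (code D)) \<longleftrightarrow> (c, Under) \<in> set (concat (code D))"
    using assms unfolding well_formed_def by blast
  have "c \<in> labels D \<longleftrightarrow> (\<exists>s. (c, s) \<in> set (concat (code D)))"
    unfolding labels_def by force
  with * show ?thesis by (metis (full_types) strand.exhaust)
qed

text \<open>A 2-colouring is represented by the set of half-edges of colour 1.\<close>

definition smoothing_compatible :: "diagram \<Rightarrow> half_edge set \<Rightarrow> strand \<Rightarrow> nat \<Rightarrow> bool" where
  "smoothing_compatible D F s c \<longleftrightarrow> (\<forall>e. ((c, s), e) \<in> F \<longleftrightarrow> ccw D ((c, s), e) \<in> F)"

text \<open>These are the constraints shared by all states: nothing is required at classical
  crossings, where the states differ.\<close>

definition colourings :: "diagram \<Rightarrow> half_edge set set" where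
  "colourings D =
     invariant_sets (half_edges D)
       (arcs D \<union> {(((c, s), In), ((c, s), Out)) | c s. c \<in> labels D \<and> kind D c = Virtual})"

lemma finite_half_edges: "finite (half_edges D)"
proof -
  have "(UNIV :: side set) = {In, Out}" using side.exhaust by auto
  then have "finite (UNIV :: side set)" by (metis finite.emptyI finite.insertI)
  then show ?thesis by (simp add: half_edges_def)
qed

lemma finite_colourings: "finite (colourings D)"
proof -
  have "colourings D \<subseteq> Pow (half_edges D)" by (auto simp: colourings_def invariant_sets_def)
  then show ?thesis using finite_half_edges by (metis finite_Pow_iff finite_subset)
qed

text \<open>The joins of a state at a classical crossing demand exactly compatibility with its
  smoothing, where \<open>Over\<close> encodes the B-smoothing and \<open>Under\<close> the
  A-smoothing.\<close>

lemma invariant_sets_joins: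
  assumes "S \<subseteq> classical D"
  shows "invariant_sets (half_edges D) (arcs D \<union> joins D S) =
    {F \<in> colourings D. (\<forall>c\<in>S. smoothing_compatible D F Over c) \<and>
       (\<forall>c\<in>classical D - S. smoothing_compatible D F Under c)}"
proof -
  define v where "v = {(((c, s :: strand), In), ((c, s), Out)) | c s. c \<in> labels D \<and> kind D c = Virtual}"
  define a where "a = {(((c, Under), e), ccw D ((c, Under), e)) | c e. c \<in> classical D - S}"
  define b where "b = {(((c, Over), e), ccw D ((c, Over), e)) | c e. c \<in> classical D \<inter> S}"
  have "joins D S = v \<union> a \<union> b"
    by (simp add: joins_def v_def a_def b_def)
  then have "invariant_sets (half_edges D) (arcs D \<union> joins D S) =
      {F \<in> colourings D. (\<forall>(x, y)\<in>b. x \<in> F \<longleftrightarrow> y \<in> F) \<and> (\<forall>(x, y)\<in>a. x \<in> F \<longleftrightarrow> y \<in> F)}"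
    unfolding invariant_sets_def colourings_def v_def[symmetric]
    by (simp add: ball_Un conj_ac)
  moreover have "(\<forall>(x, y)\<in>a. x \<in> F \<longleftrightarrow> y \<in> F) \<longleftrightarrow>
      (\<forall>c\<in>classical D - S. smoothing_compatible D F Under c)" for F
    unfolding smoothing_compatible_def a_def by blast
  moreover have "(\<forall>(x, y)\<in>b. x \<in> F \<longleftrightarrow> y \<in> F) \<longleftrightarrow>
      (\<forall>c\<in>S. smoothing_compatible D F Over c)" for F
    unfolding smoothing_compatible_def b_def using assms by blast
  ultimately show ?thesis by simp
qed

lemma arcs_joins_subset:
  assumes "well_formed D"
  shows "arcs D \<union> joins D S \<subseteq> half_edges D \<times> half_edges D"
proof -
  have he: "((c, s), e) \<in> half_edges D \<longleftrightarrow> c \<in> labels D" for c s e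
    using passage_iff[OF assms, of c s] by (simp add: half_edges_def)
  have "arcs D \<subseteq> half_edges D \<times> half_edges D"
  proof
    fix p assume "p \<in> arcs D"
    then obtain w k where w: "w \<in> set (code D)" "k < length w"
      and p: "p = ((w ! k, Out), (w ! (Suc k mod length w), In))"
      by (auto simp: arcs_def)
    have "Suc k mod length w < length w" using w by (intro mod_less_divisor) auto
    then show "p \<in> half_edges D \<times> half_edges D"
      using w by (auto simp: p half_edges_def intro!: bexI[of _ w] nth_mem)
  qed
  moreover have "joins D S \<subseteq> half_edges D \<times> half_edges D"
    by (auto simp: joins_def he classical_def)
  ultimately show ?thesis by blast
qed

text \<open>Once states and colourings are summed in the other order, the sum over states factors
  over the crossings. Circles without crossings carry no half-edges, so they enter as a separate
  power of 2.\<close>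

lemma bracket_one:
  assumes "well_formed D"
  shows "bracket D 1 = 2 ^ length (filter (\<lambda>w. w = []) (code D)) *
    (\<Sum>F\<in>colourings D. \<Prod>c\<in>classical D.
        of_bool (smoothing_compatible D F Under c) - of_bool (smoothing_compatible D F Over c))"
proof -
  let ?z = "2 ^ length (filter (\<lambda>w. w = []) (code D)) :: real"
  let ?a = "\<lambda>F c. of_bool (smoothing_compatible D F Under c) :: real"
  let ?b = "\<lambda>F c. of_bool (smoothing_compatible D F Over c) :: real"
  let ?C = "classical D"
  \<comment> \<open>The products of indicators select the colourings that are constant on every
    circle of the state \<open>S\<close>.\<close>
  have state: "(- 1) ^ card S * 2 ^ num_circles D S =
      ?z * (\<Sum>F\<in>colourings D. (\<Prod>c\<in>S. - ?b F c) * (\<Prod>c\<in>?C - S. ?a F c))"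
    if S: "S \<subseteq> ?C" for S
  proof -
    have fin: "finite S" using S by (rule finite_subset) simp
    have "(\<Sum>F\<in>colourings D. (\<Prod>c\<in>S. - ?b F c) * (\<Prod>c\<in>?C - S. ?a F c)) =
        (\<Sum>F\<in>colourings D. (- 1) ^ card S * of_bool ((\<forall>c\<in>S. smoothing_compatible D F Over c) \<and>
           (\<forall>c\<in>?C - S. smoothing_compatible D F Under c)))"
      using fin by (simp add: prod_uminus prod_of_bool of_bool_conj algebra_simps)
    also have "\<dots> = (- 1) ^ card S * real (card (invariant_sets (half_edges D) (arcs D \<union> joins D S)))"
      unfolding invariant_sets_joins[OF S] sum_distrib_left[symmetric]
      using finite_colourings by (simp add: Int_def)
    also have "\<dots> = (- 1) ^ card S * 2 ^ num_classes (half_edges D) (arcs D \<union> joins D S)"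
      using card_invariant_sets[OF finite_half_edges arcs_joins_subset[OF assms]] by simp
    finally show ?thesis by (simp add: num_circles_def power_add)
  qed
  have "bracket D 1 = (\<Sum>S\<in>Pow ?C. (- 1) ^ card S * 2 ^ num_circles D S)"
    unfolding bracket_def by (subst skein_state_sum) simp_all
  also have "\<dots> = (\<Sum>S\<in>Pow ?C. ?z * (\<Sum>F\<in>colourings D. (\<Prod>c\<in>S. - ?b F c) * (\<Prod>c\<in>?C - S. ?a F c)))"
    by (intro sum.cong) (auto simp: state)
  also have "\<dots> = ?z * (\<Sum>F\<in>colourings D. \<Sum>S\<in>Pow ?C. (\<Prod>c\<in>S. - ?b F c) * (\<Prod>c\<in>?C - S. ?a F c))"
    by (simp add: sum_distrib_left[symmetric] sum.swap[of _ "colourings D"])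
  \<comment> \<open>Here \<open>S\<close> is the set of crossings at which the term
    \<open>- ?b F c\<close> is picked when the product is expanded.\<close>
  also have "\<dots> = ?z * (\<Sum>F\<in>colourings D. \<Prod>c\<in>?C. - ?b F c + ?a F c)"
    by (simp only: prod_add[OF finite_classical])
  finally show ?thesis by simp
qed

section \<open>Switching colourings\<close>

text \<open>The inequality of truth values is an exclusive or: the colour changes at a classical
  passage and is kept at a virtual one.\<close>

definition switching :: "diagram \<Rightarrow> half_edge set \<Rightarrow> passage \<Rightarrow> bool" where
  "switching D F x \<longleftrightarrow> ((x, Out) \<in> F \<longleftrightarrow> ((x, In) \<in> F) \<noteq> (kind D (fst x) \<noteq> Virtual))"

definition switching_colourings :: "diagram \<Rightarrow> half_edge set set" where
  "switching_colourings D =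
     {F \<in> invariant_sets (half_edges D) (arcs D). \<forall>x\<in>set (concat (code D)). switching D F x}"

section \<open>Local weights at a crossing\<close>

lemma all_side: "(\<forall>e. P e) \<longleftrightarrow> P In \<and> P Out"
  by (metis side.exhaust)

text \<open>If both smoothings are compatible, all four ends have the same colour and the terms
  cancel. If exactly one is, both strands switch; at a positive crossing it is the A-smoothing when
  the incoming colours differ and the B-smoothing when they agree. A negative crossing exchanges the
  two roles.\<close>

lemma crossing_weight:
  assumes "kind D c \<noteq> Virtual"
  shows "of_bool (smoothing_compatible D F Under c) - of_bool (smoothing_compatible D F Over c) =
    (if switching D F (c, Over) \<and> switching D F (c, Under)
     then (if kind D c = Negative then -1 else 1) *
       (-1) ^ Suc (of_bool (((c, Over), In) \<in> F) + of_bool (((c, Under), In) \<in> F))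
     else (0::real))"
  using assms unfolding smoothing_compatible_def switching_def all_side
  by (cases "kind D c"; cases "((c, Over), In) \<in> F"; cases "((c, Over), Out) \<in> F";
      cases "((c, Under), In) \<in> F"; cases "((c, Under), Out) \<in> F") simp_all

text \<open>At a classical passage the outgoing colour is 1 minus the incoming one, at a virtual
  passage they are equal. The terms are arranged to avoid subtraction of natural numbers.\<close>

lemma sum_list_switching:
  assumes "\<forall>x\<in>set w. switching D F x"
  shows "sum_list (map (\<lambda>x. of_bool ((x, Out) \<in> F)) w) +
      2 * length (filter (\<lambda>x. kind D (fst x) \<noteq> Virtual \<and> (x, In) \<in> F) w) =
    sum_list (map (\<lambda>x. of_bool ((x, In) \<in> F)) w) + length (filter (\<lambda>x. kind D (fst x) \<noteq> Virtual) w)"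
  using assms by (induction w) (auto simp: switching_def)

text \<open>
  Along a closed word the colours of the outgoing half-edges are those of the incoming ones, shifted
  by one position; but each classical passage exchanges the two colours.
\<close>

lemma switching_half:
  assumes "F \<in> switching_colourings D" "w \<in> set (code D)"
  shows "length (filter (\<lambda>x. kind D (fst x) \<noteq> Virtual) w) =
    2 * length (filter (\<lambda>x. kind D (fst x) \<noteq> Virtual \<and> (x, In) \<in> F) w)"
proof -
  have "map (\<lambda>x. of_bool ((x, Out) \<in> F) :: nat) w = map (\<lambda>x. of_bool ((x, In) \<in> F)) (rotate1 w)"
  proof (rule nth_equalityI)
    fix k assume k: "k < length (map (\<lambda>x. of_bool ((x, Out) \<in> F) :: nat) w)"
    then have "((w ! k, Out), (w ! (Suc k mod length w), In)) \<in> arcs D"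
      using assms(2) by (auto simp: arcs_def)
    then have "(w ! k, Out) \<in> F \<longleftrightarrow> (w ! (Suc k mod length w), In) \<in> F"
      using assms(1) by (auto simp: switching_colourings_def invariant_sets_def)
    then show "map (\<lambda>x. of_bool ((x, Out) \<in> F) :: nat) w ! k =
        map (\<lambda>x. of_bool ((x, In) \<in> F)) (rotate1 w) ! k"
      using k by (simp add: nth_rotate1)
  qed simp
  then have "sum_list (map (\<lambda>x. of_bool ((x, Out) \<in> F) :: nat) w) =
      sum_list (map (\<lambda>x. of_bool ((x, In) \<in> F)) w)"
    by (cases w) simp_all
  moreover have "\<forall>x\<in>set w. switching D F x"
    using assms by (auto simp: switching_colourings_def)
  ultimately show ?thesis using sum_list_switching[of w D F] by simp
qed

section \<open>The product of the local weights\<close>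

lemma length_filter_concat_double:
  assumes "\<forall>w\<in>set ws. length (filter p w) = 2 * length (filter r w)"
  shows "length (filter p (concat ws)) = 2 * length (filter r (concat ws))"
  using assms by (induction ws) auto

lemma UNIV_strand: "(UNIV :: strand set) = {Over, Under}"
  using strand.exhaust by auto

lemma passages_eq: "well_formed D \<Longrightarrow> set (concat (code D)) = labels D \<times> UNIV"
  using passage_iff by fastforce

text \<open>A classical crossing has two passages, and by \<open>switching_half\<close> half of all
  classical passages have incoming colour 1. The proof regroups these passages by crossing.\<close>

lemma sum_classical_In:
  assumes wf: "well_formed D" and F: "F \<in> switching_colourings D"
  shows "(\<Sum>c\<in>classical D. of_bool (((c, Over), In) \<in> F) + of_bool (((c, Under), In) \<in> F)) =
    card (classical D)"
proof -
  let ?P = "concat (code D)"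
  let ?cl = "\<lambda>x. kind D (fst x) \<noteq> Virtual"
  have dist: "distinct ?P" using wf by (simp add: well_formed_def)
  have card: "length (filter p ?P) = card {x \<in> set ?P. p x}" for p
    using distinct_card[of "filter p ?P"] dist by simp
  have "{x \<in> set ?P. ?cl x} = classical D \<times> UNIV"
    unfolding passages_eq[OF wf] by (auto simp: classical_def)
  then have "length (filter ?cl ?P) = 2 * card (classical D)"
    unfolding card by (simp add: UNIV_strand card_cartesian_product)
  moreover have "{x \<in> set ?P. ?cl x \<and> (x, In) \<in> F} = (classical D \<times> UNIV) \<inter> {x. (x, In) \<in> F}"
    unfolding passages_eq[OF wf] by (auto simp: classical_def)
  then have "length (filter (\<lambda>x. ?cl x \<and> (x, In) \<in> F) ?P) =
      (\<Sum>x\<in>classical D \<times> UNIV. of_bool ((x, In) \<in> F))"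
    unfolding card by (simp add: UNIV_strand)
  moreover have "(\<Sum>x\<in>classical D \<times> UNIV. of_bool ((x, In) \<in> F) :: nat) =
      (\<Sum>c\<in>classical D. of_bool (((c, Over), In) \<in> F) + of_bool (((c, Under), In) \<in> F))"
    by (simp only: sum.cartesian_product' UNIV_strand)
      (simp del: sum_of_bool_eq add: sum.insert_if)
  moreover have "length (filter ?cl ?P) = 2 * length (filter (\<lambda>x. ?cl x \<and> (x, In) \<in> F) ?P)"
    by (rule length_filter_concat_double) (use switching_half[OF F] in blast)
  ultimately show ?thesis by linarith
qed

lemma switching_weight:
  assumes wf: "well_formed D" and F: "F \<in> switching_colourings D"
  shows "(\<Prod>c\<in>classical D.
      of_bool (smoothing_compatible D F Under c) - of_bool (smoothing_compatible D F Over c)) =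
    (-1 :: real) ^ num_neg D"
proof -
  let ?n = "\<lambda>c. of_bool (((c, Over), In) \<in> F) + of_bool (((c, Under), In) \<in> F) :: nat"
  have "switching D F (c, s)" if "c \<in> classical D" for c s
    using F that passages_eq[OF wf] by (auto simp: switching_colourings_def classical_def)
  then have "(\<Prod>c\<in>classical D.
      of_bool (smoothing_compatible D F Under c) - of_bool (smoothing_compatible D F Over c)) =
    (\<Prod>c\<in>classical D. (if kind D c = Negative then -1 else 1) * (-1 :: real) ^ Suc (?n c))"
    by (intro prod.cong) (auto simp: crossing_weight classical_def)
  also have "\<dots> = (\<Prod>c\<in>classical D. if kind D c = Negative then -1 else 1) *
      (-1) ^ (\<Sum>c\<in>classical D. Suc (?n c))"
    by (simp only: prod.distrib power_sum)
  \<comment> \<open>The incoming colours and the successors contribute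
    \<open>card (classical D)\<close> each, so the exponent is even and only the signs of the
    crossings remain.\<close>
  also have "(\<Sum>c\<in>classical D. Suc (?n c)) = 2 * card (classical D)"
    using sum_classical_In[OF wf F] by (simp add: sum_Suc)
  also have "(\<Prod>c\<in>classical D. if kind D c = Negative then -1 else 1 :: real) =
      (-1) ^ card {c \<in> classical D. kind D c = Negative}"
    by (simp add: prod.If_cases Int_def)
  also have "{c \<in> classical D. kind D c = Negative} = {c \<in> labels D. kind D c = Negative}"
    by (auto simp: classical_def)
  finally show ?thesis by (simp add: num_neg_def)
qed

text \<open>A colouring that fails to switch somewhere has a vanishing local weight; every other
  colouring has the same weight, by \<open>switching_weight\<close>.\<close>

lemma sum_weights:
  assumes wf: "well_formed D"
  shows "(\<Sum>F\<in>colourings D. \<Prod>c\<in>classical D.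
        of_bool (smoothing_compatible D F Under c) - of_bool (smoothing_compatible D F Over c)) =
    (-1 :: real) ^ num_neg D * card (switching_colourings D)"
proof -
  have sub: "switching_colourings D \<subseteq> colourings D"
  proof
    fix F assume F: "F \<in> switching_colourings D"
    have "((c, s), In) \<in> F \<longleftrightarrow> ((c, s), Out) \<in> F" if "c \<in> labels D" "kind D c = Virtual" for c s
    proof -
      have "switching D F (c, s)"
        using F that passage_iff[OF wf] unfolding switching_colourings_def by blast
      then show ?thesis using that by (simp add: switching_def)
    qed
    then show "F \<in> colourings D"
      using F unfolding switching_colourings_def colourings_def invariant_sets_def by auto
  qed
  have zero: "(\<Prod>c\<in>classical D.
      of_bool (smoothing_compatible D F Under c) - of_bool (smoothing_compatible D F Over c)) = (0::real)"
    if F: "F \<in> colourings D - switching_colourings D" for F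
  proof -
    from F have F1: "F \<in> colourings D" by simp
    then have "F \<in> invariant_sets (half_edges D) (arcs D)"
      by (auto simp: colourings_def invariant_sets_def)
    with F obtain c s where c: "(c, s) \<in> set (concat (code D))" "\<not> switching D F (c, s)"
      unfolding switching_colourings_def by auto
    then have lab: "c \<in> labels D" using passages_eq[OF wf] by auto
    \<comment> \<open>Colourings are constant along virtual passages, so the failure to switch
      occurs at a classical crossing.\<close>
    have "kind D c \<noteq> Virtual"
    proof
      assume "kind D c = Virtual"
      then have "((c, s), In) \<in> F \<longleftrightarrow> ((c, s), Out) \<in> F"
        using F1 lab unfolding colourings_def invariant_sets_def by blast
      then show False using c \<open>kind D c = Virtual\<close> by (auto simp: switching_def)
    qed
    moreover have "\<not> (switching D F (c, Over) \<and> switching D F (c, Under))"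
      using c(2) by (cases s) auto
    ultimately show ?thesis
      using lab by (intro prod_zero) (auto simp: crossing_weight classical_def)
  qed
  have "(\<Sum>F\<in>colourings D. \<Prod>c\<in>classical D.
        of_bool (smoothing_compatible D F Under c) - of_bool (smoothing_compatible D F Over c)) =
      (\<Sum>F\<in>switching_colourings D. \<Prod>c\<in>classical D.
        of_bool (smoothing_compatible D F Under c) - of_bool (smoothing_compatible D F Over c) :: real)"
    by (rule sum.mono_neutral_right[OF finite_colourings sub]) (use zero in blast)
  also have "\<dots> = (\<Sum>F\<in>switching_colourings D. (-1) ^ num_neg D)"
    by (intro sum.cong refl switching_weight[OF wf])
  finally show ?thesis by simp
qed

section \<open>Counting the switching colourings\<close>

definition even_word :: "diagram \<Rightarrow> passage list \<Rightarrow> bool" where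
  "even_word D w \<longleftrightarrow> even (length (filter (\<lambda>x. kind D (fst x) \<noteq> Virtual) w))"

text \<open>A switching colouring is determined by the colours of the first half-edges of the words.\<close>

lemma card_switching_colourings_even:
  assumes wf: "well_formed D" and ev: "\<forall>w\<in>set (code D). even_word D w"
  shows "card (switching_colourings D) = 2 ^ length (filter (\<lambda>w. w \<noteq> []) (code D))"
proof -
  define W where "W = {w \<in> set (code D). w \<noteq> []}"
  define n where "n w k = length (filter (\<lambda>x. kind D (fst x) \<noteq> Virtual) (take k w))" for w :: "passage list" and k
  \<comment> \<open>\<open>G T\<close> is the colouring in which exactly the words in
    \<open>T\<close> start with colour 1. The colour flips once for each classical passage made so
    far; an outgoing half-edge comes after its own passage, hence \<open>Suc k\<close>.\<close>
  define G where "G T = {(w ! k, e) | w k e. w \<in> W \<and> k < length w \<and>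
      (w \<in> T) \<noteq> odd (n w (if e = Out then Suc k else k))}" for T
  have dist: "distinct (concat (code D))" using wf by (simp add: well_formed_def)
  have unique: "w = w' \<and> k = k'"
    if "w \<in> W" "w' \<in> W" "k < length w" "k' < length w'" "w ! k = w' ! k'" for w w' k k'
  proof -
    have "w ! k \<in> set w \<inter> set w'" using that by (metis IntI nth_mem)
    then have "w = w'" using dist that(1,2) unfolding distinct_concat_iff W_def by blast
    then show ?thesis
      using that dist nth_eq_iff_index_eq[of w k k'] unfolding distinct_concat_iff W_def by blast
  qed
  have n_0: "n w 0 = 0" for w by (simp add: n_def)
  have n_Suc: "n w (Suc k) = n w k + of_bool (kind D (fst (w ! k)) \<noteq> Virtual)" if "k < length w" for w k
    using that by (simp add: n_def take_Suc_conv_app_nth)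
  have n_length: "even (n w (length w))" if "w \<in> W" for w
    using ev that by (simp add: n_def W_def even_word_def)
  have G_iff: "(w ! k, e) \<in> G T \<longleftrightarrow> (w \<in> T) \<noteq> odd (n w (if e = Out then Suc k else k))"
    if "w \<in> W" "k < length w" for w k e T
    using that unique unfolding G_def by blast
  have W_I: "w \<in> W" if "w \<in> set (code D)" "k < length w" for w k
    using that by (auto simp: W_def)
  have passage: "\<exists>w k. w \<in> W \<and> k < length w \<and> x = w ! k" if "x \<in> set (concat (code D))" for x
  proof -
    from that obtain w where "w \<in> set (code D)" "x \<in> set w" by auto
    then show ?thesis using W_I by (metis in_set_conv_nth)
  qed
  have G_switching: "G T \<in> switching_colourings D" for T
  proof -
    have "G T \<subseteq> half_edges D"
      by (auto simp: G_def half_edges_def W_def)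
    moreover have "(h \<in> G T) = (h' \<in> G T)" if hh': "(h, h') \<in> arcs D" for h h'
    proof -
      from hh' obtain w k where w: "w \<in> set (code D)" "k < length w"
        and h: "h = (w ! k, Out)" "h' = (w ! (Suc k mod length w), In)"
        by (auto simp: arcs_def)
      have k: "Suc k mod length w < length w" using w by (intro mod_less_divisor) auto
      \<comment> \<open>Only the arc from the last passage back to the first needs the evenness of
        the word: there the position jumps from \<open>length w\<close> to 0.\<close>
      have "odd (n w (Suc k)) = odd (n w (Suc k mod length w))"
      proof (cases "Suc k = length w")
        case True
        then show ?thesis using n_length[OF W_I[OF w]] n_0[of w] by simp
      qed (use w in simp)
      then show ?thesis
        using G_iff[OF W_I[OF w] w(2)] G_iff[OF W_I[OF w] k] by (simp add: h)
    qed
    moreover have "switching D (G T) x" if "x \<in> set (concat (code D))" for x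
      using passage[OF that] by (auto simp: switching_def G_iff n_Suc)
    ultimately show ?thesis
      unfolding switching_colourings_def invariant_sets_def by blast
  qed
  \<comment> \<open>Walking along the word from its first half-edge forces all other
    colours.\<close>
  have colour: "(w ! k, e) \<in> F \<longleftrightarrow> ((w ! 0, In) \<in> F) \<noteq> odd (n w (if e = Out then Suc k else k))"
    if F: "F \<in> switching_colourings D" and w: "w \<in> W" and k: "k < length w" for F w k e
  proof -
    have sw: "(w ! k, Out) \<in> F \<longleftrightarrow> ((w ! k, In) \<in> F) \<noteq> (kind D (fst (w ! k)) \<noteq> Virtual)"
      if "k < length w" for k
    proof -
      have "w ! k \<in> set (concat (code D))" using w nth_mem[OF that] by (auto simp: W_def)
      then show ?thesis using F unfolding switching_colourings_def switching_def by blast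
    qed
    have at_In: "(w ! k, In) \<in> F \<longleftrightarrow> ((w ! 0, In) \<in> F) \<noteq> odd (n w k)"
      using k
    proof (induction k)
      case (Suc k)
      have "((w ! k, Out), (w ! (Suc k mod length w), In)) \<in> arcs D"
        using w Suc.prems unfolding arcs_def W_def by fastforce
      then have "(w ! k, Out) \<in> F \<longleftrightarrow> (w ! Suc k, In) \<in> F"
        using F Suc.prems by (auto simp: switching_colourings_def invariant_sets_def)
      then show ?case using sw[of k] Suc n_Suc[of k w] by auto
    qed (simp add: n_0)
    show ?thesis
      using at_In sw[OF k] n_Suc[OF k] by (cases e) auto
  qed
  have "bij_betw (\<lambda>F. {w \<in> W. (w ! 0, In) \<in> F}) (switching_colourings D) (Pow W)"
  proof (rule bij_betw_byWitness[where f' = G])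
    show "\<forall>F\<in>switching_colourings D. G {w \<in> W. (w ! 0, In) \<in> F} = F"
    proof (intro ballI)
      fix F assume F: "F \<in> switching_colourings D"
      let ?T = "{w \<in> W. (w ! 0, In) \<in> F}"
      have "h \<in> G ?T \<longleftrightarrow> h \<in> F" if "h \<in> half_edges D" for h
      proof -
        from that obtain w k e where "w \<in> W" "k < length w" "h = (w ! k, e)"
          using passage unfolding half_edges_def by blast
        then show ?thesis using colour[OF F] G_iff by simp
      qed
      moreover have "G ?T \<subseteq> half_edges D" "F \<subseteq> half_edges D"
        using F G_switching unfolding switching_colourings_def invariant_sets_def by blast+
      ultimately show "G ?T = F" by blast
    qed
    show "\<forall>T\<in>Pow W. {w \<in> W. (w ! 0, In) \<in> G T} = T"
      using G_iff[of _ 0 In] n_0 by (auto simp: W_def)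
  qed (use G_switching in auto)
  then have "card (switching_colourings D) = card (Pow W)" by (rule bij_betw_same_card)
  also have "\<dots> = 2 ^ card W" by (rule card_Pow) (simp add: W_def)
  \<comment> \<open>Empty words may be repeated in \<open>code D\<close>, but nonempty words have
    disjoint sets of passages and hence are distinct.\<close>
  also have "card W = length (filter (\<lambda>w. w \<noteq> []) (code D))"
  proof -
    have "distinct (filter (\<lambda>w. w \<noteq> []) (code D))"
      using dist unfolding distinct_concat_iff removeAll_filter_not_eq by (simp add: eq_commute)
    from distinct_card[OF this] show ?thesis by (simp add: W_def)
  qed
  finally show ?thesis .
qed

text \<open>By \<open>switching_half\<close>, a switching colouring makes the number of classical
  passages of each word even.\<close>

lemma switching_colourings_empty:
  assumes "\<not> (\<forall>w\<in>set (code D). even_word D w)"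
  shows "switching_colourings D = {}"
  using assms switching_half[of _ D] by (auto simp: even_word_def)

text \<open>Each component contributes a factor 2: an empty word as a free circle, a nonempty one
  through the choice of its first colour.\<close>

lemma bracket_one_even_words:
  assumes wf: "well_formed D"
  shows "bracket D 1 =
    (if \<forall>w\<in>set (code D). even_word D w then (-1) ^ num_neg D * 2 ^ num_comps D else 0)"
proof -
  have "length (filter (\<lambda>w. w = []) (code D)) + length (filter (\<lambda>w. w \<noteq> []) (code D)) = num_comps D"
    unfolding num_comps_def by (rule sum_length_filter_compl)
  then show ?thesis
    unfolding bracket_one[OF wf] sum_weights[OF wf]
    using card_switching_colourings_even[OF wf] switching_colourings_empty[of D]
    by (auto simp flip: power_add)
qed

section \<open>Parities of components\<close>

lemma comp_of_eq:
  assumes "well_formed D" "i < num_comps D" "x \<in> set (code D ! i)"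
  shows "comp_of D x = i"
proof -
  have dist: "distinct (concat (code D))" using assms(1) by (simp add: well_formed_def)
  have "j = i" if "j < length (code D)" "x \<in> set (code D ! j)" for j
    using distinct_concat_nth[OF dist, of i j x] distinct_concat_nth[OF dist, of j i x] that assms
      linorder_neqE_nat[of i j] unfolding num_comps_def by blast
  then show ?thesis
    using assms(2,3) unfolding comp_of_def num_comps_def by - (rule the_equality, blast+)
qed

lemma passage_in_comp_iff:
  assumes wf: "well_formed D" and i: "i < num_comps D"
  shows "(c, s) \<in> set (code D ! i) \<longleftrightarrow> c \<in> labels D \<and> comp_of D (c, s) = i"
proof
  assume c: "(c, s) \<in> set (code D ! i)"
  then have "(c, s) \<in> set (concat (code D))" using i by (auto simp: num_comps_def)
  then show "c \<in> labels D \<and> comp_of D (c, s) = i"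
    using comp_of_eq[OF wf i c] passage_iff[OF wf] by blast
next
  assume c: "c \<in> labels D \<and> comp_of D (c, s) = i"
  then have "(c, s) \<in> set (concat (code D))" using passage_iff[OF wf] by blast
  then obtain w where "w \<in> set (code D)" "(c, s) \<in> set w" by auto
  then obtain j where "j < num_comps D" "(c, s) \<in> set (code D ! j)"
    by (metis in_set_conv_nth num_comps_def)
  then show "(c, s) \<in> set (code D ! i)" using c comp_of_eq[OF wf] by blast
qed

lemma even_card_sym_diff:
  assumes "finite A" "finite B"
  shows "even (card ((A - B) \<union> (B - A))) \<longleftrightarrow> even (card A + card B)"
proof -
  have "card A = card (A \<inter> B) + card (A - B)" "card B = card (A \<inter> B) + card (B - A)"
    using card_Int_Diff[OF assms(1), of B] card_Int_Diff[OF assms(2), of A] by (simp_all add: Int_commute)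
  moreover have "card ((A - B) \<union> (B - A)) = card (A - B) + card (B - A)"
    using assms by (intro card_Un_disjoint) auto
  ultimately have "card A + card B = card ((A - B) \<union> (B - A)) + 2 * card (A \<inter> B)"
    by linarith
  then show ?thesis by simp
qed

text \<open>Each self-crossing is passed twice, so that only the mixed crossings matter modulo 2.\<close>

lemma parity_in_eq_0_iff:
  assumes wf: "well_formed D" and i: "i < num_comps D"
  shows "parity_in D {..<num_comps D} i = 0 \<longleftrightarrow> even_word D (code D ! i)"
proof -
  define A where "A s = {c \<in> classical D. comp_of D (c, s) = i}" for s
  have fin: "finite (A s)" for s by (simp add: A_def)
  have comp: "comp_of D (c, s) < num_comps D" if "c \<in> classical D" for c s
    using comp_of_less[OF wf] that by (simp add: classical_def)
  \<comment> \<open>A crossing of component \<open>i\<close> is mixed iff exactly one of its two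
    strands belongs to \<open>i\<close>.\<close>
  have "(\<Union>j\<in>{..<num_comps D} - {i}. crossings_between D i j) = (A Over - A Under) \<union> (A Under - A Over)"
    using comp by (auto simp: A_def crossings_between_def doubleton_eq_iff)
  then have "parity_in D {..<num_comps D} i = 0 \<longleftrightarrow> even (card (A Over) + card (A Under))"
    by (simp add: parity_in_def even_card_sym_diff fin flip: even_iff_mod_2_eq_zero)
  \<comment> \<open>Tagging with the strand turns crossings into passages, so that a self-crossing
    counts twice.\<close>
  also have "card (A Over) + card (A Under) = card (A Over \<times> {Over} \<union> A Under \<times> {Under})"
    by (subst card_Un_disjoint) (auto simp: fin card_cartesian_product)
  also have "A Over \<times> {Over} \<union> A Under \<times> {Under} =
      set (filter (\<lambda>x. kind D (fst x) \<noteq> Virtual) (code D ! i))"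
    using passage_in_comp_iff[OF wf i] by (auto simp: A_def classical_def) (metis strand.exhaust)+
  also have "card \<dots> = length (filter (\<lambda>x. kind D (fst x) \<noteq> Virtual) (code D ! i))"
    using wf i nth_mem[of i "code D"] unfolding well_formed_def distinct_concat_iff num_comps_def
    by (intro distinct_card distinct_filter) blast
  finally show ?thesis by (simp add: even_word_def)
qed

lemma even_link_iff:
  assumes "well_formed D"
  shows "even_link D \<longleftrightarrow> (\<forall>w\<in>set (code D). even_word D w)"
  using parity_in_eq_0_iff[OF assms]
  by (auto simp: even_link_def even_sublink_def all_set_conv_all_nth num_comps_def)

section \<open>Bracket and Jones polynomial at 1\<close>

lemma bracket_one_eq:
  assumes "well_formed D"
  shows "bracket D 1 = (if even_link D then (-1) ^ num_neg D * 2 ^ num_comps D else 0)"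
  using bracket_one_even_words[OF assms] even_link_iff[OF assms] by simp

lemma minus_one_powi_mult_power: "(-1 :: real) powi (- int n) * (-1) ^ n = 1"
  by (simp add: power_int_minus)

lemma jones_one:
  assumes "well_formed D"
  shows "jones D 1 = (if even_link D then 2 ^ num_comps D else 0)"
  using minus_one_powi_mult_power[of "num_neg D"]
  by (simp add: jones_def bracket_one_eq[OF assms])

section \<open>The unoriented Jones polynomial of an even link\<close>

lemma core_even_sublink: "even_sublink D X \<Longrightarrow> core D X = X"
  unfolding core_def by (subst Least_eq_0) simp_all

text \<open>All components lie in the first core, so the core distance is 0 and the sign twist is
  trivial.\<close>

lemma ulk_even_link:
  assumes "even_link D" "i < num_comps D" "j < num_comps D"
  shows "ulk D i j = lk D i j"
proof -
  have "multi_core D 0 = {..<num_comps D}"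
    using assms(1) by (simp add: multi_core_def even_link_def core_even_sublink)
  then have "core_distance D i j = 0"
    using assms(2,3) by (auto simp: core_distance_def intro!: exI[of _ 0])
  then show ?thesis by (simp add: ulk_def)
qed

text \<open>Each mixed crossing lies between exactly one pair of components \<open>i < j\<close>, so
  the linking numbers add up to half the sum of all mixed signs.\<close>

lemma lambda_tilde_even_link:
  assumes wf: "well_formed D" and ev: "even_link D"
  shows "lambda_tilde D = of_int (\<Sum>c\<in>mixed_crossings D. crossing_sign D c) / 2"
proof -
  let ?P = "{(i, j). i < j \<and> j < num_comps D}"
  have fin: "finite ?P"
    by (rule finite_subset[of _ "{..<num_comps D} \<times> {..<num_comps D}"]) auto
  have mix: "mixed_crossings D = (\<Union>p\<in>?P. crossings_between D (fst p) (snd p))"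
  proof (intro equalityI subsetI)
    fix c assume c: "c \<in> mixed_crossings D"
    let ?i = "comp_of D (c, Over)" and ?j = "comp_of D (c, Under)"
    from c have cl: "c \<in> classical D" and ne: "?i \<noteq> ?j" by (auto simp: mixed_crossings_def)
    then have "(min ?i ?j, max ?i ?j) \<in> ?P"
      using comp_of_less[OF wf] by (auto simp: classical_def)
    moreover have "c \<in> crossings_between D (min ?i ?j) (max ?i ?j)"
      using cl by (auto simp: crossings_between_def min_def max_def)
    ultimately show "c \<in> (\<Union>p\<in>?P. crossings_between D (fst p) (snd p))" by force
  qed (auto simp: crossings_between_def mixed_crossings_def doubleton_eq_iff)
  have "lambda_tilde D = (\<Sum>p\<in>?P. lk D (fst p) (snd p))"
    unfolding lambda_tilde_def by (intro sum.cong) (auto simp: ulk_even_link[OF ev])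
  also have "\<dots> = of_int (\<Sum>p\<in>?P. \<Sum>c\<in>crossings_between D (fst p) (snd p). crossing_sign D c) / 2"
    by (simp add: lk_def sum_divide_distrib)
  also have "(\<Sum>p\<in>?P. \<Sum>c\<in>crossings_between D (fst p) (snd p). crossing_sign D c) =
      (\<Sum>c\<in>mixed_crossings D. crossing_sign D c)"
    unfolding mix
    by (rule sum.UNION_disjoint[symmetric, OF fin])
      (auto simp: crossings_between_def doubleton_eq_iff)
  finally show ?thesis .
qed

text \<open>Half of the sign minus 1/2 is 0 at a positive and -1 at a negative mixed crossing;
  \<open>self_neg\<close> supplies the remaining negative crossings.\<close>

lemma unoriented_exponent_even_link:
  assumes "well_formed D" "even_link D"
  shows "lambda_tilde D - real (self_neg D) - real (card (mixed_crossings D)) / 2 = - real (num_neg D)"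
proof -
  let ?M = "mixed_crossings D"
  let ?N = "{c \<in> ?M. kind D c = Negative}"
  let ?S = "{c \<in> labels D. kind D c = Negative \<and> comp_of D (c, Over) = comp_of D (c, Under)}"
  have fin: "finite ?M" by (simp add: mixed_crossings_def)
  have "(\<Sum>c\<in>?M. crossing_sign D c) = (\<Sum>c\<in>?M. 1 - 2 * of_bool (kind D c = Negative))"
    by (intro sum.cong) (auto simp: crossing_sign_def mixed_crossings_def classical_def intro: kind.exhaust)
  also have "\<dots> = int (card ?M) - 2 * int (card ?N)"
    using fin by (simp add: sum_subtractf Int_def flip: sum_distrib_left)
  finally have "lambda_tilde D - real (card ?M) / 2 = - real (card ?N)"
    by (simp add: lambda_tilde_even_link[OF assms] diff_divide_distrib)
  moreover have "num_neg D = card (?S \<union> ?N)"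
    unfolding num_neg_def by (rule arg_cong[of _ _ card]) (auto simp: mixed_crossings_def classical_def)
  moreover have "card (?S \<union> ?N) = self_neg D + card ?N"
    unfolding self_neg_def using fin by (intro card_Un_disjoint) (auto simp: mixed_crossings_def)
  ultimately show ?thesis by simp
qed

lemma unoriented_jones_one:
  assumes "well_formed D"
  shows "unoriented_jones D 1 = jones D 1"
proof (cases "even_link D")
  case True
  have "\<lfloor>- real (num_neg D)\<rfloor> = - int (num_neg D)"
    using floor_of_int[of "- int (num_neg D)"] by simp
  then show ?thesis
    unfolding unoriented_jones_def unoriented_exponent_even_link[OF assms True] jones_def by simp
qed (simp add: unoriented_jones_def jones_def bracket_one_eq[OF assms])

section \<open>Independence of the orientation\<close>

definition rename_virtual :: "nat set \<Rightarrow> diagram \<Rightarrow> passage \<Rightarrow> passage" where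
  "rename_virtual I D x =
     (fst x, if kind D (fst x) = Virtual \<and> toggled I D (fst x) then other (snd x) else snd x)"

lemma code_reorient:
  "code (reorient I D) =
     map (\<lambda>i. map (rename_virtual I D) (if i \<in> I then rev (code D ! i) else code D ! i)) [0..<num_comps D]"
  by (simp add: reorient_def rename_virtual_def case_prod_beta)

lemma kind_reorient_virtual: "kind (reorient I D) c = Virtual \<longleftrightarrow> kind D c = Virtual"
  by (simp add: reorient_def split: kind.split)

lemma num_comps_reorient: "num_comps (reorient I D) = num_comps D"
  by (simp add: num_comps_def code_reorient)

lemma mset_concat_map_cong:
  "(\<And>i. i \<in> set xs \<Longrightarrow> mset (f i) = mset (g i)) \<Longrightarrow> mset (concat (map f xs)) = mset (concat (map g xs))"
  by (induction xs) auto

lemma rename_virtual_involution: "rename_virtual I D (rename_virtual I D x) = x"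
proof -
  have "other (other s) = s" for s by (cases s) simp_all
  then show ?thesis by (cases x) (simp add: rename_virtual_def)
qed

text \<open>Reversing words preserves the multiset of passages, and the renaming is an involution
  that keeps the label of each crossing.\<close>

lemma well_formed_reorient:
  assumes wf: "well_formed D"
  shows "well_formed (reorient I D)"
proof -
  have "concat (code (reorient I D)) = map (rename_virtual I D)
      (concat (map (\<lambda>i. if i \<in> I then rev (code D ! i) else code D ! i) [0..<num_comps D]))"
    by (simp add: code_reorient map_concat comp_def)
  moreover have "mset (concat (map (\<lambda>i. if i \<in> I then rev (code D ! i) else code D ! i) [0..<num_comps D])) =
      mset (concat (map (\<lambda>i. code D ! i) [0..<num_comps D]))"
    by (rule mset_concat_map_cong) simp
  ultimately have mset: "mset (concat (code (reorient I D))) = mset (map (rename_virtual I D) (concat (code D)))"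
    by (simp add: num_comps_def map_nth del: mset_concat)
  have inj: "inj_on (rename_virtual I D) A" for A
    by (rule inj_on_inverseI[where g = "rename_virtual I D"]) (rule rename_virtual_involution)
  have "distinct (concat (code D))" using wf by (simp add: well_formed_def)
  then have "distinct (concat (code (reorient I D)))"
    using mset_eq_imp_distinct_iff[OF mset] inj by (simp only: distinct_map)
  moreover have "set (concat (code (reorient I D))) = rename_virtual I D ` (labels D \<times> UNIV)"
    using mset_eq_setD[OF mset] passages_eq[OF wf] by (simp only: set_map)
  moreover have "(c, s) \<in> rename_virtual I D ` (labels D \<times> UNIV) \<longleftrightarrow> c \<in> labels D" for c s
  proof
    assume "c \<in> labels D"
    then have "rename_virtual I D (c, s) \<in> labels D \<times> UNIV" by (simp add: rename_virtual_def)
    then show "(c, s) \<in> rename_virtual I D ` (labels D \<times> UNIV)"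
      by (metis image_eqI rename_virtual_involution)
  qed (auto simp: rename_virtual_def)
  ultimately show ?thesis unfolding well_formed_def by simp
qed

text \<open>The number of classical passages of a word survives reversal, sign changes and the
  exchange of strands at virtual crossings.\<close>

lemma even_link_reorient:
  assumes wf: "well_formed D"
  shows "even_link (reorient I D) \<longleftrightarrow> even_link D"
proof -
  have "even_word (reorient I D) (map (rename_virtual I D) w) \<longleftrightarrow> even_word D w" for w
    by (simp add: even_word_def filter_map comp_def kind_reorient_virtual rename_virtual_def)
  moreover have "even_word D (rev w) \<longleftrightarrow> even_word D w" for w
    by (simp add: even_word_def flip: rev_filter)
  ultimately have "even_word (reorient I D) (code (reorient I D) ! i) \<longleftrightarrow> even_word D (code D ! i)"
    if "i < num_comps D" for i
    using that by (simp add: code_reorient)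
  then show ?thesis
    unfolding even_link_iff[OF wf] even_link_iff[OF well_formed_reorient[OF wf]] all_set_conv_all_nth
    using num_comps_reorient[of I D] by (simp add: num_comps_def)
qed

text \<open>Both ends of every move are virtual link diagrams, so this property spreads over a whole
  equivalence class.\<close>

lemma virtual_links_well_formed:
  assumes "L \<in> virtual_links" "D \<in> L"
  shows "well_formed D"
proof -
  obtain E where E: "virtual_link_diagram E" "(E, D) \<in> (moves \<union> moves\<inverse>)\<^sup>*"
    using assms by (auto simp: virtual_links_def quotient_def)
  from E(2,1) have "virtual_link_diagram D"
    by (induction rule: rtrancl_induct) (auto simp: moves_def)
  then show ?thesis by (simp add: virtual_link_diagram_def)
qed

theorem theorem5:
  fixes L :: "diagram set" and D :: diagram
  assumes "L \<in> virtual_links" and "D \<in> L"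
  shows "unoriented_jones D 1 = jones D 1 \<and>
         jones D 1 = (if even_link D then 2 ^ num_comps D else 0) \<and>
         (\<forall>I \<subseteq> {..<num_comps D}. jones (reorient I D) 1 = jones D 1)"
proof -
  have wf: "well_formed D" using assms by (rule virtual_links_well_formed)
  \<comment> \<open>The value at 1 depends only on evenness and the number of components, which
    \<open>reorient\<close> preserves.\<close>
  then show ?thesis
    by (simp add: unoriented_jones_one jones_one well_formed_reorient even_link_reorient num_comps_reorient)
qed

end
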